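(* Let $(X,f_{1,\infty})$ be a non-autonomous discrete system. If $f_{1,\infty}$ is weakly mixing, then $f_{1,\infty}$ is Kato chaotic.
   Context: $\mathbb{N}=\{1,2,3,\dots\}$. A non-autonomous discrete system (NDS) $(X,f_{1,\infty})$ consists of a metric space $(X,d)$ and a sequence $f_{1,\infty}=(f_n)_{n=1}^\infty$ of continuous maps $f_n:X\to X$. For $i,n\in\mathbb{N}$, $f_i^n:=f_{i+n-1}\circ\cdots\circ f_i$. Weakly mixing: for any four non-empty open sets $U_1,U_2,V_1,V_2\subseteq X$ there is $n\in\mathbb{N}$ with $f_1^n(U_1)\cap V_1\neq\emptyset$ and $f_1^n(U_2)\cap V_2\neq\emptyset$. Sensitive: there is $\delta>0$ such that for any non-empty open set $U\subseteq X$ there exist $x,y\in U$ and $n\in\mathbb{N}$ with $d(f_1^n(x),f_1^n(y))>\delta$. Accessible: for any $\varepsilon>0$ and any non-empty open sets $U,V\subseteq X$ there exist $x\in U$, $y\in V$ and $n\in\mathbb{N}$ with $d(f_1^n(x),f_1^n(y))<\varepsilon$. Kato chaotic: sensitive and accessible.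
   Formalization: The formal theorem additionally assumes that X is not a one-point space: on a single point every system is weakly mixing but not sensitive, so the claim as stated fails there. *)

theory Defs
  imports "HOL-Analysis.Analysis"
begin

text \<open>
  The maps of a non-autonomous discrete system are indexed by the positive integers; the value
  \<open>f 0\<close> of the sequence is never used and is left unconstrained.
  The composition \<open>nds_comp f i n\<close> is $f_{i+n-1} \circ \cdots \circ f_i$ (the identity for \<open>n = 0\<close>).
\<close>

primrec nds_comp :: "(nat \<Rightarrow> 'a \<Rightarrow> 'a) \<Rightarrow> nat \<Rightarrow> nat \<Rightarrow> 'a \<Rightarrow> 'a" where
  "nds_comp f i 0 = id"
| "nds_comp f i (Suc n) = f (i + n) \<circ> nds_comp f i n"

text \<open>
  \<open>continuous_map\<close> includes that each \<open>f n\<close> maps the carrier \<open>X\<close> into itself.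
\<close>

locale nds = Metric_space X d
  for X :: "'a set" and d :: "'a \<Rightarrow> 'a \<Rightarrow> real" +
  fixes f :: "nat \<Rightarrow> 'a \<Rightarrow> 'a"
  assumes continuous: "\<And>n. n \<ge> 1 \<Longrightarrow> continuous_map mtopology mtopology (f n)"
begin

definition weakly_mixing :: bool where
  "weakly_mixing \<longleftrightarrow>
    (\<forall>U1 U2 V1 V2.
       openin mtopology U1 \<and> U1 \<noteq> {} \<and> openin mtopology U2 \<and> U2 \<noteq> {} \<and>
       openin mtopology V1 \<and> V1 \<noteq> {} \<and> openin mtopology V2 \<and> V2 \<noteq> {} \<longrightarrow>
       (\<exists>n\<ge>1. nds_comp f 1 n ` U1 \<inter> V1 \<noteq> {} \<and> nds_comp f 1 n ` U2 \<inter> V2 \<noteq> {}))"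

definition sensitive :: bool where
  "sensitive \<longleftrightarrow>
    (\<exists>\<delta>>0. \<forall>U. openin mtopology U \<and> U \<noteq> {} \<longrightarrow>
       (\<exists>x\<in>U. \<exists>y\<in>U. \<exists>n\<ge>1. d (nds_comp f 1 n x) (nds_comp f 1 n y) > \<delta>))"

definition accessible :: bool where
  "accessible \<longleftrightarrow>
    (\<forall>\<epsilon>>0. \<forall>U V. openin mtopology U \<and> U \<noteq> {} \<and> openin mtopology V \<and> V \<noteq> {} \<longrightarrow>
       (\<exists>x\<in>U. \<exists>y\<in>V. \<exists>n\<ge>1. d (nds_comp f 1 n x) (nds_comp f 1 n y) < \<epsilon>))"

text \<open>
  A system on a one-point space is weakly mixing but not sensitive, hence not Kato chaotic.
\<close>

definition Kato_chaotic :: bool where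
  "Kato_chaotic \<longleftrightarrow> sensitive \<and> accessible"

end

end

theory Submission
  imports Defs
begin

text \<open>Weak mixing steers two open sets, at one common time, into any two prescribed balls;
  \<open>weakly_mixing_hits_balls\<close> packages this. Aiming one open set at balls around two
  distinct points tears some of its points apart, which gives sensitivity. Aiming two open sets at
  the same small ball brings a point of each together, which gives accessibility.\<close>

context nds
begin

text \<open>Nothing forbids \<open>U1 = U2\<close> or \<open>a = b\<close>: sensitivity uses the
  first coincidence, accessibility the second.\<close>

lemma weakly_mixing_hits_balls:
  assumes "weakly_mixing" and "openin mtopology U1" "U1 \<noteq> {}" "openin mtopology U2" "U2 \<noteq> {}"
    and "a \<in> X" "b \<in> X" "r > 0"
  obtains x y n where "x \<in> U1" "y \<in> U2" "n \<ge> 1"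
    "nds_comp f 1 n x \<in> mball a r" "nds_comp f 1 n y \<in> mball b r"
proof -
  have "mball a r \<noteq> {}" "mball b r \<noteq> {}"
    using assms by auto
  then have "\<exists>n\<ge>1. nds_comp f 1 n ` U1 \<inter> mball a r \<noteq> {} \<and> nds_comp f 1 n ` U2 \<inter> mball b r \<noteq> {}"
    using assms(2-5) openin_mball
    by (intro assms(1)[unfolded weakly_mixing_def, rule_format]) simp
  then obtain n where "n \<ge> 1" "nds_comp f 1 n ` U1 \<inter> mball a r \<noteq> {}"
      "nds_comp f 1 n ` U2 \<inter> mball b r \<noteq> {}"
    by blast
  with that show thesis
    by blast
qed

text \<open>Two distinct points \<open>a\<close>, \<open>b\<close> of the space fix the sensitivity
  constant \<open>d a b / 2\<close> before any open set is chosen.\<close>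

lemma weakly_mixing_imp_sensitive:
  assumes "weakly_mixing" and "\<not> is_singleton X"
  shows "sensitive"
\<comment> \<open>\<open>\<not> is_singleton X\<close> still admits the empty space. There no
  non-empty open set exists, so any positive constant works, and 1 is taken.\<close>
proof (cases "X = {}")
  case True
  have "U = {}" if "openin mtopology U" for U
    using openin_subset[OF that] True topspace_mtopology by blast
  then show ?thesis
    unfolding sensitive_def using zero_less_one by blast
next
  case False
  then obtain a b where ab: "a \<in> X" "b \<in> X" "a \<noteq> b"
    using assms(2) is_singletonI'[of X] by blast
  then have pos: "d a b > 0"
    by simp
  have "\<exists>x\<in>U. \<exists>y\<in>U. \<exists>n\<ge>1. d (nds_comp f 1 n x) (nds_comp f 1 n y) > d a b / 2"
    if U: "openin mtopology U" "U \<noteq> {}" for U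
  proof -
    \<comment> \<open>\<open>U\<close> serves as both source sets. With radius
      \<open>d a b / 4\<close> the two errors together cost less than half of \<open>d a b\<close>,
      leaving the images more than \<open>d a b / 2\<close> apart.\<close>
    obtain x y n where *: "x \<in> U" "y \<in> U" "n \<ge> 1"
      "nds_comp f 1 n x \<in> mball a (d a b / 4)" "nds_comp f 1 n y \<in> mball b (d a b / 4)"
      using weakly_mixing_hits_balls[OF assms(1) U U ab(1,2), of "d a b / 4"] pos by auto
    define p q where "p = nds_comp f 1 n x" and "q = nds_comp f 1 n y"
    have pq: "p \<in> X" "q \<in> X" "d a p < d a b / 4" "d b q < d a b / 4"
      using * by (auto simp: p_def q_def)
    have "d a b \<le> d a p + d p b" "d p b \<le> d p q + d q b"
      using triangle ab pq by blast+
    then have "d p q > d a b / 2"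
      using pq commute[of q b] by linarith
    then show ?thesis
      using * unfolding p_def q_def by blast
  qed
  then show ?thesis
    unfolding sensitive_def using pos half_gt_zero by blast
qed

lemma weakly_mixing_imp_accessible:
  assumes "weakly_mixing"
  shows "accessible"
  unfolding accessible_def
proof (intro allI impI, elim conjE)
  fix \<epsilon> :: real and U V
  assume eps: "\<epsilon> > 0" and U: "openin mtopology U" "U \<noteq> {}" and V: "openin mtopology V" "V \<noteq> {}"
  \<comment> \<open>Any centre will do; \<open>U\<close> being non-empty guarantees that one exists.
    Two points within \<epsilon>/2 of it are less than \<epsilon> apart.\<close>
  obtain a where a: "a \<in> X"
    using openin_subset[OF U(1)] U(2) topspace_mtopology by blast
  obtain x y n where *: "x \<in> U" "y \<in> V" "n \<ge> 1"
    "nds_comp f 1 n x \<in> mball a (\<epsilon> / 2)" "nds_comp f 1 n y \<in> mball a (\<epsilon> / 2)"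
    using weakly_mixing_hits_balls[OF assms U V a a, of "\<epsilon> / 2"] eps by auto
  have "d (nds_comp f 1 n x) (nds_comp f 1 n y) \<le> d a (nds_comp f 1 n x) + d a (nds_comp f 1 n y)"
    using * a by (intro triangle'') auto
  also have "\<dots> < \<epsilon>"
    using * by auto
  finally show "\<exists>x\<in>U. \<exists>y\<in>V. \<exists>n\<ge>1. d (nds_comp f 1 n x) (nds_comp f 1 n y) < \<epsilon>"
    using * by blast
qed

end

theorem theorem2:
  fixes X :: "'a set" and d :: "'a \<Rightarrow> 'a \<Rightarrow> real" and f :: "nat \<Rightarrow> 'a \<Rightarrow> 'a"
  assumes "nds X d f"
    and "\<not> is_singleton X"
    and "nds.weakly_mixing X d f"
  shows "nds.Kato_chaotic X d f"
proof -
  interpret nds X d f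
    by fact
  show ?thesis
    unfolding Kato_chaotic_def
    using assms weakly_mixing_imp_sensitive weakly_mixing_imp_accessible by blast
qed

end
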